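(* Let $n=p^m$ where $p$ is a prime and $m\ge1$ is an integer. Then: (a) $$\mathrm{Ap}(S(B_n),p^{m-1}) = \Big\{\frac1p\sum_{i=1}^{m-1}c_i\binom n{p^i} \;\Big|\; c_i\in\mathbb{Z},\ 0\le c_i\le p-1\Big\};$$ (b) the Frobenius number is $$F(S(B_n)) = \frac{p-1}{p}\sum_{i=1}^{m-1}\binom{p^m}{p^i} - p^{m-1};$$ (c) the genus is $$g(S(B_n)) = \frac{p-1}{2p}\sum_{i=1}^{m-1}\binom{p^m}{p^i} - \frac{p^{m-1}-1}{2};$$ (d) the set of pseudo-Frobenius numbers is $$PF(S(B_n)) = \Big\{\frac{p-1}{p}\sum_{i=1}^{m-1}\binom{p^m}{p^i} - p^{m-1}\Big\},$$ and the type is $t(S(B_n))=1$.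
   Context: $\mathbb{N}$ is the set of nonnegative integers. For nonempty $A\subseteq\mathbb{N}$, $\langle A\rangle$ denotes the submonoid of $(\mathbb{N},+)$ generated by $A$. A numerical semigroup is a submonoid of $\mathbb{N}$ with finite complement. For $n=p^m$ a prime power, $S(B_n) = \left\langle \frac1p\binom n1,\frac1p\binom n2,\dots,\frac1p\binom n{n-1}\right\rangle$, which is a numerical semigroup. For a numerical semigroup $S$: the Frobenius number $F(S)$ is the greatest integer not in $S$ (so $F(\mathbb{N})=-1$); the genus $g(S)$ is the cardinality of $\mathbb{N}\setminus S$; for $x\in S\setminus\{0\}$, $\mathrm{Ap}(S,x)=\{s\in S: s-x\notin S\}$; an integer $x$ is a pseudo-Frobenius number of $S$ if $x\notin S$ and $x+s\in S$ for all $s\in S\setminus\{0\}$; $PF(S)$ is the set of pseudo-Frobenius numbers and the type $t(S)$ is its cardinality. Empty sums equal $0$. *)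

theory Defs
  imports "HOL-Number_Theory.Number_Theory"
begin

definition is_submonoid :: "nat set \<Rightarrow> bool" where
  "is_submonoid M \<longleftrightarrow> 0 \<in> M \<and> (\<forall>x\<in>M. \<forall>y\<in>M. x + y \<in> M)"

definition generated_submonoid :: "nat set \<Rightarrow> nat set" where
  "generated_submonoid A = is_submonoid hull A"

definition numerical_semigroup :: "nat set \<Rightarrow> bool" where
  "numerical_semigroup S \<longleftrightarrow> is_submonoid S \<and> finite (UNIV - S)"

text \<open>Membership of a possibly negative integer \<open>x\<close> in \<open>S\<close> is expressed as \<open>x \<in> int ` S\<close>.\<close>

definition frobenius_number :: "nat set \<Rightarrow> int" where
  "frobenius_number S = (GREATEST x::int. x \<notin> int ` S)"

definition genus :: "nat set \<Rightarrow> nat" where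
  "genus S = card (UNIV - S)"

definition apery_set :: "nat set \<Rightarrow> nat \<Rightarrow> nat set" where
  "apery_set S x = {s \<in> S. int s - int x \<notin> int ` S}"

definition pseudo_frobenius :: "nat set \<Rightarrow> int set" where
  "pseudo_frobenius S = {x. x \<notin> int ` S \<and> (\<forall>s \<in> S - {0}. x + int s \<in> int ` S)}"

definition semigroup_type :: "nat set \<Rightarrow> nat" where
  "semigroup_type S = card (pseudo_frobenius S)"

text \<open>For \<open>n\<close> a power of the prime \<open>p\<close> the division below is exact (\<open>prime_dvd_choose_prime_power\<close>).\<close>

definition binomial_semigroup :: "nat \<Rightarrow> nat \<Rightarrow> nat set" where
  "binomial_semigroup p n = generated_submonoid {(n choose k) div p | k. 1 \<le> k \<and> k \<le> n - 1}"

lemma prime_dvd_choose_prime_power: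
  fixes p m k :: nat
  assumes "prime p" "1 \<le> k" "k \<le> p ^ m - 1"
  shows "p dvd (p ^ m choose k)"
proof (rule ccontr)
  assume "\<not> p dvd (p ^ m choose k)"
  then have cop: "coprime (p ^ m) (p ^ m choose k)"
    using assms(1) by (simp add: prime_imp_coprime)
  have "k * (p ^ m choose k) = p ^ m * ((p ^ m - 1) choose (k - 1))"
    using times_binomial_minus1_eq[of k "p ^ m"] assms by simp
  then have "p ^ m dvd k * (p ^ m choose k)" by simp
  then have "p ^ m dvd k"
    using cop by (simp add: coprime_dvd_mult_left_iff)
  then have "p ^ m \<le> k" using assms(2) by (intro dvd_imp_le) auto
  moreover have "p ^ m > 0" using assms(1) by (simp add: prime_gt_0_nat)
  ultimately show False using assms(3) by linarith
qed

lemma not_prime_dvd_choose_prime_power_minus_1: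
  fixes p m j :: nat
  assumes "prime p" "j \<le> p ^ m - 1"
  shows "\<not> p dvd ((p ^ m - 1) choose j)"
  using assms(2)
proof (induction j)
  case 0
  then show ?case using assms(1) by auto
next
  case (Suc j)
  have "p ^ m = Suc (p ^ m - 1)" using assms(1) by (simp add: prime_gt_0_nat)
  then have "p ^ m choose Suc j = ((p ^ m - 1) choose j) + ((p ^ m - 1) choose Suc j)"
    by (metis binomial_Suc_Suc)
  moreover have "p dvd (p ^ m choose Suc j)"
    using prime_dvd_choose_prime_power[OF assms(1), of "Suc j" m] Suc.prems by simp
  moreover have "\<not> p dvd ((p ^ m - 1) choose j)" using Suc by simp
  ultimately show ?case by (metis dvd_add_left_iff)
qed

lemma is_submonoid_generated: "is_submonoid (generated_submonoid A)"
  unfolding generated_submonoid_def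
  by (rule hull_in) (auto simp: is_submonoid_def)

lemma is_submonoid_mult:
  assumes "is_submonoid M" "x \<in> M"
  shows "k * x \<in> M"
  using assms by (induction k) (auto simp: is_submonoid_def)

lemma numerical_semigroup_binomial_semigroup:
  fixes p m :: nat
  assumes p: "prime p" and m: "m \<ge> 1"
  shows "numerical_semigroup (binomial_semigroup p (p ^ m))"
proof -
  let ?S = "binomial_semigroup p (p ^ m)"
  let ?a = "p ^ (m - 1)"
  let ?b = "(p ^ m - 1) choose (?a - 1)"
  have p0: "p > 0" and p2: "p \<ge> 2" using p by (auto simp: prime_gt_0_nat prime_ge_2_nat)
  have pm: "p ^ m = p * ?a" using m by (cases m) auto
  have a1: "?a \<ge> 1" using p0 by (simp add: Suc_leI)
  have "2 * ?a \<le> p * ?a" using p2 by (rule mult_le_mono1)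
  then have pm2: "?a \<le> p ^ m - 1" using pm a1 by linarith
  have sub: "is_submonoid ?S"
    unfolding binomial_semigroup_def by (rule is_submonoid_generated)
  have gen: "(p ^ m choose k) div p \<in> ?S" if "1 \<le> k" "k \<le> p ^ m - 1" for k
    unfolding binomial_semigroup_def generated_submonoid_def
    by (rule hull_inc) (use that in blast)
  have aS: "?a \<in> ?S"
  proof -
    have "1 \<le> p ^ m - 1" using pm2 a1 by linarith
    moreover have "(p ^ m choose 1) div p = ?a" using p0 by (simp add: pm)
    ultimately show ?thesis using gen[of 1] by simp
  qed
  have "?a * (p ^ m choose ?a) = ?a * (p * ?b)"
  proof -
    have "?a * (p ^ m choose ?a) = p ^ m * ?b"
      using a1 by (intro times_binomial_minus1_eq) linarith
    also have "\<dots> = ?a * (p * ?b)" by (simp only: pm mult_ac)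
    finally show ?thesis .
  qed
  then have "p ^ m choose ?a = p * ?b" using p0 by simp
  then have bS: "?b \<in> ?S"
  proof -
    have "(p ^ m choose ?a) div p = ?b"
      using \<open>p ^ m choose ?a = p * ?b\<close> p0 by simp
    then show ?thesis using gen[OF a1 pm2] by simp
  qed
  have "\<not> p dvd ?b"
    using not_prime_dvd_choose_prime_power_minus_1[OF p, of "?a - 1" m] pm2 by linarith
  then have cop: "coprime ?b ?a"
    using p by (metis coprime_commute coprime_power_right_iff prime_imp_coprime)
  have big: "N \<in> ?S" if N: "N \<ge> ?a * ?b" for N
  proof -
    obtain x where x: "[?b * x = 1] (mod ?a)"
      using cong_solve_coprime_nat[OF cop] by auto
    define y where "y = (x * N) mod ?a"
    have ya: "y < ?a" using p0 by (simp add: y_def)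
    have "[?b * y = ?b * (x * N)] (mod ?a)"
      by (simp add: y_def cong_def mod_mult_right_eq)
    also have "[?b * (x * N) = N] (mod ?a)"
      using cong_scalar_right[OF x, of N] by (simp add: mult.assoc)
    finally have c: "[?b * y = N] (mod ?a)" .
    have "?b * y \<le> ?b * ?a" using ya by (intro mult_le_mono2 less_imp_le)
    also have "\<dots> \<le> N" using N by (simp only: mult.commute)
    finally have le: "?b * y \<le> N" .
    have "?a dvd N - ?b * y"
      using cong_sym[OF c] le by (simp only: cong_altdef_nat)
    then obtain z where "N - ?b * y = ?a * z" by blast
    then have "N = ?a * z + ?b * y" using le by linarith
    then have "N = z * ?a + y * ?b" by (simp only: mult.commute)
    moreover have "z * ?a \<in> ?S" "y * ?b \<in> ?S"
      using is_submonoid_mult[OF sub aS] is_submonoid_mult[OF sub bS] by blast+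
    ultimately show ?thesis
      using sub unfolding is_submonoid_def by blast
  qed
  have "UNIV - ?S \<subseteq> {..<?a * ?b}" using big by (auto simp: not_less[symmetric])
  then have "finite (UNIV - ?S)" by (rule finite_subset) simp
  with sub show ?thesis by (simp add: numerical_semigroup_def)
qed

end

theory Submission
  imports Defs
begin

text \<open>Put \<open>M = m - 1\<close> and let \<open>b\<^sub>i\<close> be the generator at \<open>k = p ^ i\<close>. It is \<open>p ^ (M - i)\<close> times a number
  prime to \<open>p\<close>, so the sums \<open>c\<^sub>1 b\<^sub>1 + \<dots> + c\<^sub>M b\<^sub>M\<close> with digits \<open>c\<^sub>i < p\<close> form a complete residue system
  modulo \<open>b\<^sub>0 = p ^ M\<close>. Because \<open>p b\<^sub>i \<le> b\<^sub>i\<^sub>+\<^sub>1\<close> for \<open>i \<ge> 1\<close>, carries can be absorbed by the lower digits, and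
  all generators have an expansion with nonnegative multiples of \<open>b\<^sub>0\<close>; hence the digit sums are the
  Apery set. Complementing digits, \<open>c\<^sub>i \<mapsto> p - 1 - c\<^sub>i\<close>, shows that \<open>x\<close> lies in the semigroup iff
  \<open>F - x\<close> does not, where \<open>F = (p - 1) (b\<^sub>1 + \<dots> + b\<^sub>M) - b\<^sub>0\<close>; this symmetry yields the Frobenius number,
  the genus and the pseudo-Frobenius numbers.\<close>

section \<open>Symmetric semigroups\<close>

text \<open>The condition ranges over all integers: for \<open>x > F\<close> the number
  \<open>F - x\<close> is negative, so everything above \<open>F\<close> is forced into
  \<open>S\<close>.\<close>

locale symmetric_semigroup =
  fixes S :: "nat set" and F :: int
  assumes zero_mem: "0 \<in> S"
    and symmetric: "x \<in> int ` S \<longleftrightarrow> F - x \<notin> int ` S"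
begin

lemma F_notin: "F \<notin> int ` S"
  using symmetric[of 0] zero_mem by force

lemma mem_if_greater: "F < x \<Longrightarrow> x \<in> int ` S"
  using symmetric[of x] by auto

lemma F_ge: "F \<ge> -1"
  using mem_if_greater[of "-1"] by force

lemma frobenius_number_eq: "frobenius_number S = F"
  unfolding frobenius_number_def
  using F_notin mem_if_greater by (intro Greatest_equality) (auto simp: not_less[symmetric])

text \<open>All gaps lie in \<open>{0..F}\<close>, and the reflection
  \<open>x \<mapsto> F - x\<close> swaps gaps and elements there, so the gaps are half of these
  \<open>F + 1\<close> numbers.\<close>

lemma two_genus_eq: "2 * int (genus S) = F + 1"
proof -
  let ?G = "int ` (UNIV - S)" and ?E = "int ` S \<inter> {0..F}"
  have G: "?G = {0..F} - int ` S"
  proof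
    show "?G \<subseteq> {0..F} - int ` S"
      using mem_if_greater by (fastforce simp: not_less[symmetric])
    show "{0..F} - int ` S \<subseteq> ?G"
    proof
      fix x assume x: "x \<in> {0..F} - int ` S"
      then have "x = int (nat x)" "nat x \<notin> S" by force+
      then show "x \<in> ?G" by blast
    qed
  qed
  have EG: "(\<lambda>x. F - x) ` ?E \<subseteq> ?G"
  proof
    fix y assume "y \<in> (\<lambda>x. F - x) ` ?E"
    then obtain x where "x \<in> ?E" "y = F - x" by (rule imageE)
    then show "y \<in> ?G" unfolding G using symmetric[of x] by simp
  qed
  have GE: "(\<lambda>x. F - x) ` ?G \<subseteq> ?E"
    unfolding G
  proof
    fix y assume "y \<in> (\<lambda>x. F - x) ` ({0..F} - int ` S)"
    then obtain x where "x \<in> {0..F} - int ` S" "y = F - x" by (rule imageE)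
    then show "y \<in> ?E" using symmetric[of x] by simp
  qed
  have "bij_betw (\<lambda>x. F - x) ?E ?G"
    by (rule bij_betw_byWitness[OF _ _ EG GE]) simp_all
  then have "card ?E = card ?G" by (rule bij_betw_same_card)
  moreover have "card {0..F} = card ?G + card ?E"
  proof -
    have "card {0..F} = card ({0..F} \<inter> int ` S) + card ({0..F} - int ` S)"
      by (rule card_Int_Diff) simp
    then show ?thesis unfolding G by (simp only: Int_commute add.commute)
  qed
  moreover have "card ?G = genus S"
    unfolding genus_def by (rule card_image) simp
  ultimately have "card {0..F} = 2 * genus S" by linarith
  \<comment> \<open>\<open>F \<ge> -1\<close> makes \<open>card {0..F} = F + 1\<close> correct also
    for the empty interval at \<open>F = -1\<close>.\<close>
  then show ?thesis using F_ge by simp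
qed

text \<open>For a gap \<open>x\<close>, symmetry gives \<open>s = F - x\<close> in \<open>S\<close>;
  if \<open>s\<close> were nonzero, the pseudo-Frobenius property would put \<open>x + s = F\<close>
  into \<open>S\<close>.\<close>

lemma pseudo_frobenius_eq: "pseudo_frobenius S = {F}"
proof
  show "{F} \<subseteq> pseudo_frobenius S"
    using F_notin mem_if_greater by (auto simp: pseudo_frobenius_def)
  show "pseudo_frobenius S \<subseteq> {F}"
  proof
    fix x assume x: "x \<in> pseudo_frobenius S"
    then have "x \<notin> int ` S" by (simp add: pseudo_frobenius_def)
    then obtain s where s: "s \<in> S" "F - x = int s" using symmetric[of x] by auto
    have "s = 0"
    proof (rule ccontr)
      assume "s \<noteq> 0"
      then have "x + int s \<in> int ` S" using x s by (auto simp: pseudo_frobenius_def)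
      moreover have "x + int s = F" using s by simp
      ultimately show False using F_notin by simp
    qed
    then show "x \<in> {F}" using s by simp
  qed
qed

end

section \<open>Semigroups of mixed-radix expansions\<close>

text \<open>\<open>unit_part\<close> fixes the exact power of \<open>p\<close> in
  \<open>b i\<close>; \<open>growth\<close> says that one carry \<open>p * b (Suc s)\<close> is at
  least the largest digit sum at positions \<open>1..s\<close>.\<close>

locale prime_power_radix =
  fixes p M :: nat and b :: "nat \<Rightarrow> nat"
  assumes prime: "prime p"
    and unit_part: "i \<le> M \<Longrightarrow> \<exists>u. b i = p ^ (M - i) * u \<and> coprime u p"
    and growth: "s < M \<Longrightarrow> (p - 1) * (\<Sum>i = 1..s. b i) \<le> p * b (Suc s)"
begin

definition digit_sums :: "nat \<Rightarrow> nat set" where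
  "digit_sums s = {\<Sum>i = 1..s. c i * b i | c. \<forall>i\<in>{1..s}. c i < p}"

text \<open>Position 0 is the modulus \<open>p ^ M\<close> with an unbounded coefficient. Stage
  \<open>s \<le> M\<close> reaches only multiples of \<open>p ^ (M - s)\<close>, which lets
  inductions on \<open>s\<close> peel off the top digit.\<close>

definition expansions :: "nat \<Rightarrow> nat set" where
  "expansions s = {w + k * p ^ M | w k. w \<in> digit_sums s}"

lemma p_pos: "p > 0"
  using prime by (rule prime_gt_0_nat)

lemma digit_sums_0: "digit_sums 0 = {0}"
  by (auto simp: digit_sums_def)

lemma digit_sums_Suc:
  "digit_sums (Suc s) = {w + c * b (Suc s) | w c. w \<in> digit_sums s \<and> c < p}"
proof
  show "digit_sums (Suc s) \<subseteq> {w + c * b (Suc s) | w c. w \<in> digit_sums s \<and> c < p}"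
    by (force simp: digit_sums_def)
  show "{w + c * b (Suc s) | w c. w \<in> digit_sums s \<and> c < p} \<subseteq> digit_sums (Suc s)"
  proof
    fix x assume "x \<in> {w + c * b (Suc s) | w c. w \<in> digit_sums s \<and> c < p}"
    then obtain e c where e: "\<forall>i\<in>{1..s}. e i < p" and c: "c < p"
      and x: "x = (\<Sum>i = 1..s. e i * b i) + c * b (Suc s)"
      by (auto simp: digit_sums_def)
    let ?e = "e(Suc s := c)"
    have "x = (\<Sum>i = 1..Suc s. ?e i * b i)" by (simp add: x)
    moreover have "\<forall>i\<in>{1..Suc s}. ?e i < p" using e c by auto
    ultimately show "x \<in> digit_sums (Suc s)" unfolding digit_sums_def by blast
  qed
qed

lemma expansions_Suc:
  "expansions (Suc s) = {t + c * b (Suc s) | t c. t \<in> expansions s \<and> c < p}"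
proof
  show "expansions (Suc s) \<subseteq> {t + c * b (Suc s) | t c. t \<in> expansions s \<and> c < p}"
  proof
    fix x assume "x \<in> expansions (Suc s)"
    then obtain w c k where w: "w \<in> digit_sums s" "c < p"
      and "x = w + c * b (Suc s) + k * p ^ M"
      unfolding expansions_def digit_sums_Suc by blast
    then have "x = (w + k * p ^ M) + c * b (Suc s)" by simp
    then show "x \<in> {t + c * b (Suc s) | t c. t \<in> expansions s \<and> c < p}"
      using w unfolding expansions_def by blast
  qed
  show "{t + c * b (Suc s) | t c. t \<in> expansions s \<and> c < p} \<subseteq> expansions (Suc s)"
  proof
    fix x assume "x \<in> {t + c * b (Suc s) | t c. t \<in> expansions s \<and> c < p}"
    then obtain w c k where w: "w \<in> digit_sums s" "c < p"
      and "x = w + k * p ^ M + c * b (Suc s)"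
      unfolding expansions_def by blast
    then have "x = (w + c * b (Suc s)) + k * p ^ M" by simp
    then show "x \<in> expansions (Suc s)"
      using w unfolding expansions_def digit_sums_Suc by blast
  qed
qed

lemma expansions_mono:
  assumes "s \<le> s'" shows "expansions s \<subseteq> expansions s'"
  using assms
proof (induction rule: dec_induct)
  case (step k)
  have "expansions k \<subseteq> expansions (Suc k)"
    using p_pos unfolding expansions_Suc by force
  with step.IH show ?case by blast
qed simp

section \<open>Residues of digit sums modulo powers of \<open>p\<close>\<close>

lemma digit_sums_dvd:
  assumes "s \<le> M" "w \<in> digit_sums s"
  shows "p ^ (M - s) dvd w"
proof -
  have "p ^ (M - s) dvd c * b i" if i: "i \<in> {1..s}" for c i
  proof -
    obtain u where "b i = p ^ (M - i) * u" using unit_part[of i] i assms(1) by auto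
    moreover have "p ^ (M - s) dvd p ^ (M - i)" using i by (intro le_imp_power_dvd) auto
    ultimately show ?thesis by (metis dvd_mult dvd_mult2)
  qed
  then show ?thesis using assms(2) by (auto simp: digit_sums_def intro!: dvd_sum)
qed

text \<open>Modulo \<open>p ^ (M - s)\<close> the positions up to \<open>s\<close> vanish, and the
  unit part of \<open>b (Suc s)\<close> is invertible modulo \<open>p\<close>, so the top digits
  agree. They cancel, and the lower sums are again congruent modulo the full
  \<open>p ^ M\<close>.\<close>

lemma digit_sums_inj:
  assumes "s \<le> M" "w \<in> digit_sums s" "w' \<in> digit_sums s" "[w = w'] (mod p ^ M)"
  shows "w = w'"
  using assms
proof (induction s arbitrary: w w')
  case 0
  then show ?case by (simp add: digit_sums_0)
next
  case (Suc s)
  let ?q = "p ^ (M - Suc s)"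
  obtain v c v' c' where w: "w = v + c * b (Suc s)" "v \<in> digit_sums s" "c < p"
    and w': "w' = v' + c' * b (Suc s)" "v' \<in> digit_sums s" "c' < p"
    using Suc.prems unfolding digit_sums_Suc by blast
  obtain u where u: "b (Suc s) = ?q * u" "coprime u p"
    using unit_part[of "Suc s"] Suc.prems by blast
  have pq: "p ^ (M - s) = ?q * p" using Suc.prems(1)
    by (metis Suc_diff_Suc Suc_le_lessD mult.commute power_Suc)
  have q0: "?q > 0" using p_pos by simp
  have v0: "[v = 0] (mod ?q * p)" "[v' = 0] (mod ?q * p)"
    using digit_sums_dvd[of s] w(2) w'(2) Suc.prems(1) by (simp_all add: pq[symmetric] cong_0_iff)
  have "[w = w'] (mod ?q * p)"
    using cong_dvd_modulus_nat[OF Suc.prems(4)] by (simp add: pq[symmetric] le_imp_power_dvd)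
  moreover have "[0 + c * b (Suc s) = w] (mod ?q * p)" "[w' = 0 + c' * b (Suc s)] (mod ?q * p)"
    unfolding w(1) w'(1) using cong_add[OF cong_sym[OF v0(1)] cong_refl]
      cong_add[OF v0(2) cong_refl] by blast+
  ultimately have "[0 + c * b (Suc s) = 0 + c' * b (Suc s)] (mod ?q * p)"
    by (blast intro: cong_trans)
  then have "[?q * (c * u) = ?q * (c' * u)] (mod ?q * p)" by (simp add: u(1) mult_ac)
  then have "?q * (c * u mod p) = ?q * (c' * u mod p)" by (simp only: cong_def mult_mod_right)
  then have "[c * u = c' * u] (mod p)" using q0 p_pos by (simp add: cong_def)
  then have "[c = c'] (mod p)" using u(2) by (simp add: cong_mult_rcancel_nat)
  then have c: "c = c'" using w(3) w'(3) by (simp add: cong_def)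
  then have "[v = v'] (mod p ^ M)"
    using Suc.prems(4) by (simp add: w(1) w'(1) cong_add_rcancel_nat)
  then show ?case using Suc.IH[of v v'] Suc.prems(1) w w' c by simp
qed

section \<open>Expansions of large multiples and closure under addition\<close>

text \<open>The residue of \<open>x\<close> dictates the top digit, and removing it leaves a
  multiple of the next higher power of \<open>p\<close>. The lower bound on \<open>x\<close> is the
  largest digit sum, so no subtraction goes below zero.\<close>

lemma expansions_large:
  assumes "s \<le> M" "p ^ (M - s) dvd x" "(p - 1) * (\<Sum>i = 1..s. b i) \<le> x"
  shows "x \<in> expansions s"
  using assms
proof (induction s arbitrary: x)
  case 0
  then show ?case by (auto simp: expansions_def digit_sums_0 elim!: dvdE)
next
  case (Suc s)
  let ?q = "p ^ (M - Suc s)"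
  obtain u where u: "b (Suc s) = ?q * u" "coprime u p"
    using unit_part[of "Suc s"] Suc.prems by blast
  obtain y where y: "x = ?q * y" using Suc.prems(2) by blast
  have pq: "p ^ (M - s) = ?q * p" using Suc.prems(1)
    by (metis Suc_diff_Suc Suc_le_lessD mult.commute power_Suc)
  obtain z where z: "[u * z = 1] (mod p)" using cong_solve_coprime_nat[OF u(2)] by auto
  \<comment> \<open>\<open>z\<close> inverts the unit part of \<open>b (Suc s)\<close> modulo
    \<open>p\<close>, so this digit matches \<open>x\<close> modulo
    \<open>p ^ (M - s)\<close>.\<close>
  define c where "c = (z * y) mod p"
  have cp: "c < p" using p_pos by (simp add: c_def)
  have "[u * c = u * (z * y)] (mod p)" by (simp add: c_def cong_def mod_mult_right_eq)
  also have "[u * (z * y) = y] (mod p)"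
    using cong_scalar_right[OF z, of y] by (simp add: mult.assoc)
  finally have uc: "[y = u * c] (mod p)" by (rule cong_sym)
  have "c * b (Suc s) \<le> (p - 1) * b (Suc s)" using cp by (intro mult_le_mono1) simp
  moreover have "(p - 1) * (\<Sum>i = 1..Suc s. b i)
      = (p - 1) * (\<Sum>i = 1..s. b i) + (p - 1) * b (Suc s)"
    by (simp add: distrib_left)
  ultimately have le: "(p - 1) * (\<Sum>i = 1..s. b i) + c * b (Suc s) \<le> x"
    using Suc.prems(3) by linarith
  have "[c * b (Suc s) = x] (mod ?q * p)"
  proof -
    have "?q * (u * c mod p) = ?q * (y mod p)" using uc by (simp add: cong_def)
    then show ?thesis by (simp add: cong_def mult_mod_right y u(1) mult_ac)
  qed
  then have "p ^ (M - s) dvd x - c * b (Suc s)"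
    using le by (simp only: pq cong_altdef_nat[OF order.trans[OF le_add2 le]] cong_sym_eq)
  then have "x - c * b (Suc s) \<in> expansions s"
    using Suc.prems(1) le by (intro Suc.IH) auto
  moreover have "x = (x - c * b (Suc s)) + c * b (Suc s)" using le by simp
  ultimately show ?case using cp unfolding expansions_Suc by blast
qed

lemma expansions_dvd:
  assumes "s \<le> M" "x \<in> expansions s"
  shows "p ^ (M - s) dvd x"
  using assms digit_sums_dvd[OF assms(1)]
  by (auto simp: expansions_def intro!: dvd_add dvd_mult le_imp_power_dvd)

text \<open>A carry is passed down, not up: \<open>p * b (Suc s)\<close> is divisible by
  \<open>p ^ (M - s)\<close> and, by \<open>growth\<close>, large enough for
  \<open>expansions_large\<close> to rewrite it together with the lower digits.\<close>

lemma expansions_add: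
  assumes "s \<le> M" "x \<in> expansions s" "y \<in> expansions s"
  shows "x + y \<in> expansions s"
  using assms
proof (induction s arbitrary: x y)
  case 0
  then show ?case by (auto simp: expansions_def digit_sums_0 distrib_right[symmetric])
next
  case (Suc s)
  obtain t c t' c' where x: "x = t + c * b (Suc s)" "t \<in> expansions s" "c < p"
    and y: "y = t' + c' * b (Suc s)" "t' \<in> expansions s" "c' < p"
    using Suc.prems unfolding expansions_Suc by blast
  have tt: "t + t' \<in> expansions s" using Suc x y by simp
  show ?case
  proof (cases "c + c' < p")
    case True
    moreover have "x + y = (t + t') + (c + c') * b (Suc s)"
      by (simp add: x y distrib_right)
    ultimately show ?thesis using tt unfolding expansions_Suc by blast
  next
    case False
    let ?t = "t + t' + p * b (Suc s)"
    obtain u where u: "b (Suc s) = p ^ (M - Suc s) * u"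
      using unit_part[of "Suc s"] Suc.prems by blast
    have "p * b (Suc s) = p ^ (M - s) * u" using Suc.prems(1)
      by (simp add: u Suc_diff_Suc[symmetric] Suc_le_eq)
    then have "p ^ (M - s) dvd ?t"
      using expansions_dvd[OF _ tt] Suc.prems(1) by (simp add: dvd_add)
    moreover have "(p - 1) * (\<Sum>i = 1..s. b i) \<le> ?t"
      using growth[of s] Suc.prems(1) by simp
    ultimately have "?t \<in> expansions s"
      using Suc.prems(1) by (intro expansions_large) auto
    moreover have "x + y = ?t + (c + c' - p) * b (Suc s)"
    proof -
      have "c + c' = p + (c + c' - p)" using False by simp
      then have "(c + c') * b (Suc s) = p * b (Suc s) + (c + c' - p) * b (Suc s)"
        by (metis distrib_right)
      then show ?thesis by (simp add: x y distrib_right)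
    qed
    moreover have "c + c' - p < p" using x y by simp
    ultimately show ?thesis unfolding expansions_Suc by blast
  qed
qed

lemma is_submonoid_expansions: "is_submonoid (expansions M)"
  using expansions_large[of 0 0] expansions_mono[of 0 M] expansions_add
  by (auto simp: is_submonoid_def)

lemma basis_in_expansions:
  assumes "1 \<le> i" "i \<le> M"
  shows "b i \<in> expansions i"
proof -
  obtain s where s: "i = Suc s" using assms by (cases i) auto
  have "0 \<in> expansions s"
    using expansions_large[of 0 0] expansions_mono[of 0 s] by auto
  moreover have "1 < p" using prime by (rule prime_gt_1_nat)
  ultimately show ?thesis unfolding s expansions_Suc by force
qed

section \<open>Normal form of integers, symmetry and the Apery set\<close>

lemma int_expansion:
  fixes x :: int
  obtains w k where "w \<in> digit_sums M" "x = int w + k * int (p ^ M)"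
proof -
  \<comment> \<open>Since \<open>p ^ M \<ge> 1\<close>, shifting by \<open>N * p ^ M\<close> lifts
    even a negative \<open>x\<close> above the bound of \<open>expansions_large\<close>.\<close>
  define N where "N = nat \<bar>x\<bar> + (p - 1) * (\<Sum>i = 1..M. b i)"
  have "N * 1 \<le> N * p ^ M" using p_pos by (intro mult_le_mono2) (simp add: Suc_leI)
  then have "int N \<le> int (N * p ^ M)" by (simp only: of_nat_le_iff mult_1_right)
  moreover have "\<bar>x\<bar> + int ((p - 1) * (\<Sum>i = 1..M. b i)) = int N" by (simp add: N_def)
  ultimately have ge: "int ((p - 1) * (\<Sum>i = 1..M. b i)) \<le> x + int (N * p ^ M)" by linarith
  then have "(p - 1) * (\<Sum>i = 1..M. b i) \<le> nat (x + int (N * p ^ M))" by linarith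
  then have "nat (x + int (N * p ^ M)) \<in> expansions M"
    by (intro expansions_large) auto
  then obtain w j where w: "w \<in> digit_sums M" "nat (x + int (N * p ^ M)) = w + j * p ^ M"
    by (auto simp: expansions_def)
  then have "x + int (N * p ^ M) = int (w + j * p ^ M)" using ge by linarith
  then have "x = int w + (int j - int N) * int (p ^ M)" by (simp add: algebra_simps)
  with w show ?thesis using that by blast
qed

text \<open>The residue modulo \<open>p ^ M\<close> determines \<open>w\<close> by
  \<open>digit_sums_inj\<close>, so an expansion with a natural coefficient must have that
  coefficient equal to \<open>k\<close>.\<close>

lemma int_in_expansions_iff:
  assumes "w \<in> digit_sums M"
  shows "int w + k * int (p ^ M) \<in> int ` expansions M \<longleftrightarrow> k \<ge> 0"
proof
  assume "k \<ge> 0"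
  then have "int w + k * int (p ^ M) = int (w + nat k * p ^ M)" by simp
  then show "int w + k * int (p ^ M) \<in> int ` expansions M"
    using assms unfolding expansions_def by blast
next
  assume "int w + k * int (p ^ M) \<in> int ` expansions M"
  then obtain w' j where w': "w' \<in> digit_sums M"
    and eq: "int w + k * int (p ^ M) = int w' + int j * int (p ^ M)"
    unfolding expansions_def by fastforce
  then have "int w' - int w = int (p ^ M) * (k - int j)" by (simp add: algebra_simps)
  then have "[int w' = int w] (mod int (p ^ M))" by (simp add: cong_iff_dvd_diff)
  then have "w' = w" using digit_sums_inj[OF _ w' assms] by (simp only: cong_int_iff order.refl)
  then show "k \<ge> 0" using eq p_pos by simp
qed

lemma digit_sums_reflect:
  assumes "w \<in> digit_sums s"
  shows "\<exists>w'\<in>digit_sums s. w + w' = (p - 1) * (\<Sum>i = 1..s. b i)"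
proof -
  obtain c where c: "\<forall>i\<in>{1..s}. c i < p" "w = (\<Sum>i = 1..s. c i * b i)"
    using assms by (auto simp: digit_sums_def)
  have "w + (\<Sum>i = 1..s. (p - 1 - c i) * b i) = (\<Sum>i = 1..s. (p - 1) * b i)"
    unfolding c(2) sum.distrib[symmetric]
  proof (rule sum.cong)
    fix i assume "i \<in> {1..s}"
    then have "c i + (p - 1 - c i) = p - 1" using c(1) by force
    then show "c i * b i + (p - 1 - c i) * b i = (p - 1) * b i" by (metis distrib_right)
  qed simp
  moreover have "(\<Sum>i = 1..s. (p - 1 - c i) * b i) \<in> digit_sums s"
    using p_pos unfolding digit_sums_def
    by (intro CollectI exI[of _ "\<lambda>i. p - 1 - c i"]) auto
  ultimately show ?thesis by (auto simp: sum_distrib_left)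
qed

lemma symmetric_semigroup_expansions:
  "symmetric_semigroup (expansions M) (int ((p - 1) * (\<Sum>i = 1..M. b i)) - int (p ^ M))"
    (is "symmetric_semigroup _ ?F")
proof
  show "0 \<in> expansions M" using is_submonoid_expansions by (simp add: is_submonoid_def)
  fix x :: int
  obtain w k where w: "w \<in> digit_sums M" "x = int w + k * int (p ^ M)" by (rule int_expansion)
  obtain w' where w': "w' \<in> digit_sums M" "w + w' = (p - 1) * (\<Sum>i = 1..M. b i)"
    using digit_sums_reflect[OF w(1)] by blast
  \<comment> \<open>The \<open>- 1\<close> comes from the term \<open>- p ^ M\<close> of
    \<open>?F\<close>; exactly one of \<open>k\<close> and \<open>- k - 1\<close> is
    nonnegative.\<close>
  have "?F - x = int w' + (- k - 1) * int (p ^ M)"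
    unfolding w(2) w'(2)[symmetric] by (simp add: algebra_simps)
  then show "x \<in> int ` expansions M \<longleftrightarrow> ?F - x \<notin> int ` expansions M"
    using int_in_expansions_iff[OF w(1)] int_in_expansions_iff[OF w'(1)] w(2) by auto
qed

text \<open>Subtracting \<open>p ^ M\<close> lowers the coefficient by one, and membership depends
  only on its sign, so the Apery set is the part with \<open>k = 0\<close>.\<close>

lemma apery_set_expansions: "apery_set (expansions M) (p ^ M) = digit_sums M"
proof (intro equalityI subsetI)
  fix x assume "x \<in> apery_set (expansions M) (p ^ M)"
  then have "x \<in> expansions M" and nin: "int x - int (p ^ M) \<notin> int ` expansions M"
    by (simp_all add: apery_set_def)
  then obtain w k where w: "w \<in> digit_sums M" and x: "x = w + k * p ^ M"
    unfolding expansions_def by blast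
  have "int x - int (p ^ M) = int w + (int k - 1) * int (p ^ M)" by (simp add: x algebra_simps)
  then have "k = 0" using nin int_in_expansions_iff[OF w, of "int k - 1"] by simp
  then show "x \<in> digit_sums M" using w x by simp
next
  fix x assume x: "x \<in> digit_sums M"
  then have "x \<in> expansions M" unfolding expansions_def by force
  moreover have "int x - int (p ^ M) \<notin> int ` expansions M"
    using int_in_expansions_iff[OF x, of "-1"] by simp
  ultimately show "x \<in> apery_set (expansions M) (p ^ M)" by (simp add: apery_set_def)
qed

lemma expansions_subset_submonoid:
  assumes "is_submonoid S" "p ^ M \<in> S" "\<And>i. 1 \<le> i \<Longrightarrow> i \<le> M \<Longrightarrow> b i \<in> S"
  shows "expansions M \<subseteq> S"
proof -
  have "expansions s \<subseteq> S" if "s \<le> M" for s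
    using that
  proof (induction s)
    case 0
    then show ?case using is_submonoid_mult[OF assms(1,2)]
      by (auto simp: expansions_def digit_sums_0)
  next
    case (Suc s)
    show ?case
    proof
      fix x assume "x \<in> expansions (Suc s)"
      then obtain t c where x: "x = t + c * b (Suc s)" and "t \<in> expansions s"
        by (auto simp: expansions_Suc)
      then have "t \<in> S" "c * b (Suc s) \<in> S"
        using Suc is_submonoid_mult[OF assms(1) assms(3)[of "Suc s"]] by auto
      then show "x \<in> S" using assms(1) by (simp add: x is_submonoid_def)
    qed
  qed
  then show ?thesis by simp
qed

end

section \<open>Binomial coefficients\<close>

text \<open>For \<open>a > 0\<close> the first two terms of Vandermonde's sum are
  \<open>?C + a * ?D\<close>, where \<open>?D\<close> is \<open>a / (a + 1)\<close> times
  \<open>?C\<close>; together they already reach \<open>a * ?C\<close>.\<close>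

lemma choose_triple_ge: "a * ((2 * a) choose a) \<le> (3 * a) choose a"
proof (cases a)
  case (Suc d)
  let ?C = "(2 * a) choose a" and ?D = "(2 * a) choose d"
  have "(\<Sum>k\<in>{0, 1}. (a choose k) * ((2 * a) choose (a - k)))
      \<le> (\<Sum>k\<le>a. (a choose k) * ((2 * a) choose (a - k)))"
    by (rule sum_mono2) (auto simp: Suc)
  also have "\<dots> = (3 * a) choose a" using vandermonde[of a "2 * a" a] by simp
  finally have "?C + a * ?D \<le> (3 * a) choose a" by (simp add: Suc)
  moreover have "(a + 1) * ?D = a * ?C"
    using binomial_absorb_comp[of "2 * a" d] binomial_absorption[of d "2 * a"]
    by (simp add: Suc)
  then have "(a + 1) * (a * ?C) \<le> (a + 1) * (?C + a * ?D)"
    by (simp add: algebra_simps)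
  then have "a * ?C \<le> ?C + a * ?D" by (simp only: mult_le_cancel1)
  ultimately show ?thesis by linarith
qed simp

text \<open>Choosing \<open>2 * a\<close> elements and then \<open>a\<close> of these amounts to
  choosing \<open>a\<close> twice in succession. The second choice is from
  \<open>n - a \<ge> 3 * a\<close> elements, where \<open>choose_triple_ge\<close> supplies the
  factor \<open>a\<close>.\<close>

lemma choose_double_ge:
  fixes a n :: nat
  assumes "4 * a \<le> n"
  shows "a * (n choose a) \<le> n choose (2 * a)"
proof -
  have pos: "(2 * a) choose a > 0" by (simp add: zero_less_binomial_iff)
  have "(n choose (2 * a)) * ((2 * a) choose a) = (n choose a) * ((n - a) choose a)"
    using choose_mult[of a "2 * a" n] assms by simp
  moreover have "a * ((2 * a) choose a) \<le> (n - a) choose a"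
    using choose_triple_ge[of a] binomial_right_mono[of "3 * a" "n - a" a] assms by linarith
  then have "(n choose a) * (a * ((2 * a) choose a)) \<le> (n choose a) * ((n - a) choose a)"
    by (rule mult_le_mono2)
  ultimately have "(a * (n choose a)) * ((2 * a) choose a) \<le> (n choose (2 * a)) * ((2 * a) choose a)"
    by (simp add: mult_ac)
  then show ?thesis using pos by simp
qed

text \<open>Absorption \<open>k * (n choose k) = n * ((n - 1) choose (k - 1))\<close> isolates the
  power of \<open>p\<close>; the cofactor is prime to \<open>p\<close> by
  \<open>not_prime_dvd_choose_prime_power_minus_1\<close>.\<close>

lemma prime_power_choose_eq:
  fixes p m s :: nat
  assumes "prime p" "s \<le> m"
  shows "p ^ m choose p ^ s = p ^ (m - s) * ((p ^ m - 1) choose (p ^ s - 1))"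
proof -
  have p0: "p > 0" using assms(1) by (rule prime_gt_0_nat)
  then have "p ^ s * (p ^ m choose p ^ s) = p ^ m * ((p ^ m - 1) choose (p ^ s - 1))"
    by (intro times_binomial_minus1_eq) simp
  also have "\<dots> = p ^ s * (p ^ (m - s) * ((p ^ m - 1) choose (p ^ s - 1)))"
    using assms(2) by (simp flip: mult.assoc power_add)
  finally show ?thesis using p0 by simp
qed

lemma prime_power_dvd_choose:
  fixes p m s j :: nat
  assumes "prime p" "s \<le> m" "\<not> p dvd j"
  shows "p ^ (m - s) dvd (p ^ m choose (p ^ s * j))"
proof -
  have p0: "p > 0" using assms(1) by (rule prime_gt_0_nat)
  have "j > 0" using assms(3) by (cases j) auto
  then have "p ^ s * j * (p ^ m choose (p ^ s * j)) = p ^ m * ((p ^ m - 1) choose (p ^ s * j - 1))"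
    using p0 by (intro times_binomial_minus1_eq) simp
  also have "\<dots> = p ^ s * (p ^ (m - s) * ((p ^ m - 1) choose (p ^ s * j - 1)))"
    using assms(2) by (simp flip: mult.assoc power_add)
  finally have "j * (p ^ m choose (p ^ s * j))
      = p ^ (m - s) * ((p ^ m - 1) choose (p ^ s * j - 1))"
    using p0 by (simp add: mult.assoc)
  then have "p ^ (m - s) dvd j * (p ^ m choose (p ^ s * j))" by simp
  moreover have "coprime (p ^ (m - s)) j"
    using assms by (simp add: prime_imp_coprime)
  ultimately show ?thesis by (simp add: coprime_dvd_mult_right_iff)
qed

text \<open>With \<open>a = p ^ s\<close>, \<open>choose_double_ge\<close> gains the factor
  \<open>p ^ s\<close>, at least \<open>p\<close> because \<open>s \<ge> 1\<close>; monotonicity up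
  to the middle of the row then passes from \<open>2 * p ^ s\<close> to \<open>k\<close>.\<close>

lemma choose_prime_power_growth:
  fixes p m s k :: nat
  assumes "prime p" "1 \<le> s" "2 * p ^ s \<le> k" "2 * k \<le> p ^ m"
  shows "p * (p ^ m choose p ^ s) \<le> p ^ m choose k"
proof -
  have "p ^ 1 \<le> p ^ s"
    using assms(2) prime_gt_0_nat[OF assms(1)] by (intro power_increasing) auto
  then have "p * (p ^ m choose p ^ s) \<le> p ^ s * (p ^ m choose p ^ s)" by simp
  also have "\<dots> \<le> p ^ m choose (2 * p ^ s)" using assms by (intro choose_double_ge) simp
  also have "\<dots> \<le> p ^ m choose k" using assms by (intro binomial_mono) auto
  finally show ?thesis .
qed

text \<open>The weighted sum up to \<open>s\<close> is at most
  \<open>p * d s \<le> d (Suc s)\<close>, and the \<open>p - 1\<close> new copies of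
  \<open>d (Suc s)\<close> complete this to \<open>p\<close> copies.\<close>

lemma weighted_sum_le_last:
  fixes d :: "nat \<Rightarrow> nat"
  assumes "1 \<le> s" "s \<le> M" "\<And>i. 1 \<le> i \<Longrightarrow> i < M \<Longrightarrow> p * d i \<le> d (Suc i)" "p > 0"
  shows "(p - 1) * (\<Sum>i = 1..s. d i) \<le> p * d s"
  using assms(1,2)
proof (induction s rule: dec_induct)
  case base
  then show ?case by simp
next
  case (step s)
  have "(p - 1) * (\<Sum>i = 1..Suc s. d i) = (p - 1) * (\<Sum>i = 1..s. d i) + (p - 1) * d (Suc s)"
    using step.hyps by (simp add: distrib_left)
  also have "\<dots> \<le> d (Suc s) + (p - 1) * d (Suc s)"
    using step assms(3)[of s] by simp
  also have "\<dots> = p * d (Suc s)" using assms(4) by (cases p) auto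
  finally show ?case .
qed

section \<open>The binomial semigroup\<close>

lemma prime_power_choose_div_growth:
  fixes p m s k :: nat
  assumes p: "prime p" and "1 \<le> s" "2 * p ^ s \<le> k" "2 * k \<le> p ^ m"
  shows "p * ((p ^ m choose p ^ s) div p) \<le> (p ^ m choose k) div p"
proof -
  have "1 \<le> p ^ s" using prime_gt_0_nat[OF p] by (simp add: Suc_leI)
  then have "p dvd (p ^ m choose p ^ s)" "p dvd (p ^ m choose k)"
    using assms by (auto intro!: prime_dvd_choose_prime_power)
  then obtain x y where xy: "p ^ m choose p ^ s = p * x" "p ^ m choose k = p * y" by blast
  then show ?thesis
    using choose_prime_power_growth[OF assms] prime_gt_0_nat[OF p] by simp
qed

text \<open>Side conditions of the growth lemmas for \<open>k = p ^ Suc s\<close> and exponent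
  \<open>Suc M\<close>.\<close>

lemma double_prime_power_le:
  fixes p s :: nat
  assumes "prime p" "s < M"
  shows "2 * p ^ s \<le> p ^ Suc s" "2 * p ^ Suc s \<le> p ^ Suc M"
proof -
  have p2: "p \<ge> 2" using assms(1) by (rule prime_ge_2_nat)
  then show "2 * p ^ s \<le> p ^ Suc s" by simp
  have "p ^ Suc s \<le> p ^ M" using assms p2 by (intro power_increasing) auto
  then have "2 * p ^ Suc s \<le> p * p ^ M" using p2 by (rule mult_le_mono[rotated])
  then show "2 * p ^ Suc s \<le> p ^ Suc M" by simp
qed

lemma prime_power_radix_choose:
  assumes p: "prime p"
  shows "prime_power_radix p M (\<lambda>i. (p ^ Suc M choose p ^ i) div p)"
proof
  have p0: "p > 0" using p by (rule prime_gt_0_nat)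
  show "prime p" by fact
  let ?b = "\<lambda>i. (p ^ Suc M choose p ^ i) div p"
  {
    fix i assume i: "i \<le> M"
    let ?u = "(p ^ Suc M - 1) choose (p ^ i - 1)"
    have "?b i = p ^ (M - i) * ?u"
      using prime_power_choose_eq[OF p, of i "Suc M"] i p0 by (simp add: Suc_diff_le)
    moreover have "p ^ i \<le> p ^ Suc M" using i p0 by (intro power_increasing) auto
    then have "coprime ?u p"
      using not_prime_dvd_choose_prime_power_minus_1[OF p, of "p ^ i - 1" "Suc M"]
        prime_imp_coprime[OF p] by (metis coprime_commute diff_le_mono)
    ultimately show "\<exists>u. ?b i = p ^ (M - i) * u \<and> coprime u p" by blast
  }
  fix s assume s: "s < M"
  \<comment> \<open>Position 0 is excluded: for \<open>p = 2\<close> and \<open>M = 1\<close>,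
    \<open>?b 0 = 2\<close> and \<open>?b 1 = 3\<close>.\<close>
  have g: "p * ?b i \<le> ?b (Suc i)" if "1 \<le> i" "i < M" for i
    using that double_prime_power_le[OF p that(2)]
    by (intro prime_power_choose_div_growth[OF p])
  show "(p - 1) * (\<Sum>i = 1..s. ?b i) \<le> p * ?b (Suc s)"
  proof (cases "s = 0")
    case False
    then have "(p - 1) * (\<Sum>i = 1..s. ?b i) \<le> p * ?b s"
      using s g p0 by (intro weighted_sum_le_last[where M = M]) auto
    also have "\<dots> \<le> ?b (Suc s)" using g[of s] False s by simp
    also have "\<dots> \<le> p * ?b (Suc s)" using p0 by simp
    finally show ?thesis .
  qed simp
qed

text \<open>If \<open>p ^ s\<close> is the exact power of \<open>p\<close> dividing \<open>k\<close> and \<open>k \<noteq> p ^ s\<close>, then the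
  generator at \<open>k\<close> is divisible by the greatest common divisor of the generators at
  \<open>p ^ 0, \<dots>, p ^ s\<close> and exceeds the Frobenius bound of the semigroup they generate.\<close>

lemma choose_div_in_expansions:
  fixes p M k :: nat
  assumes p: "prime p" and k: "1 \<le> k" "k \<le> p ^ Suc M - 1"
  defines "b \<equiv> \<lambda>i. (p ^ Suc M choose p ^ i) div p"
  shows "(p ^ Suc M choose k) div p \<in> prime_power_radix.expansions p M b M"
proof -
  interpret prime_power_radix p M b
    unfolding b_def using p by (rule prime_power_radix_choose)
  \<comment> \<open>Growth is available only in the lower half of the row; the upper half follows by
    replacing \<open>k\<close> with \<open>p ^ Suc M - k\<close>.\<close>
  have half: "(p ^ Suc M choose k) div p \<in> expansions M"
    if k: "1 \<le> k" "2 * k \<le> p ^ Suc M" for k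
  proof -
    have "k \<noteq> 0" "\<not> is_unit p" using k prime_gt_1_nat[OF p] by auto
    then obtain j where j: "k = p ^ multiplicity p k * j" "\<not> p dvd j"
      using multiplicity_decompose'[of k p] by metis
    define s where "s = multiplicity p k"
    have ks: "k = p ^ s * j" using j(1) by (simp only: s_def)
    have j0: "j > 0" using j(2) by (cases j) auto
    have "p ^ s \<le> k" unfolding ks using j0 by simp
    also have "k < p ^ Suc M" using k by linarith
    finally have "s < Suc M" using prime_gt_1_nat[OF p] by (simp only: power_less_imp_less_exp)
    then have s: "s \<le> M" by simp
    have "(p ^ Suc M choose k) div p \<in> expansions s"
    proof (cases "j = 1")
      case True
      show ?thesis
      \<comment> \<open>For \<open>s = 0\<close> the generator is the modulus \<open>p ^ M\<close>,
        which sits at position 0 and so outside \<open>basis_in_expansions\<close>.\<close>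
      proof (cases "s = 0")
        case True
        then show ?thesis using \<open>j = 1\<close> p_pos
          by (intro expansions_large) (auto simp: ks)
      next
        case False
        then show ?thesis using basis_in_expansions[of s] s \<open>j = 1\<close> by (simp add: ks b_def)
      qed
    next
      case False
      then have "2 * p ^ s \<le> k" unfolding ks using j0 by (simp add: mult.commute)
      then have large: "(p - 1) * (\<Sum>i = 1..s. b i) \<le> (p ^ Suc M choose k) div p"
      proof (cases "s = 0")
        case False
        have g: "p * b i \<le> b (Suc i)" if "1 \<le> i" "i < M" for i
          unfolding b_def using that double_prime_power_le[OF p that(2)]
          by (intro prime_power_choose_div_growth[OF p])
        have "(p - 1) * (\<Sum>i = 1..s. b i) \<le> p * b s"
          using s g p_pos False by (intro weighted_sum_le_last[where M = M]) auto
        also have "\<dots> \<le> (p ^ Suc M choose k) div p"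
          unfolding b_def using False \<open>2 * p ^ s \<le> k\<close> k
          by (intro prime_power_choose_div_growth[OF p]) auto
        finally show ?thesis .
      qed simp
      have "p ^ (Suc M - s) dvd p ^ Suc M choose k"
        unfolding ks using s j(2) by (intro prime_power_dvd_choose[OF p]) auto
      then obtain y where "p ^ Suc M choose k = p ^ (Suc M - s) * y" by blast
      then have "(p ^ Suc M choose k) div p = p ^ (M - s) * y"
        using s p_pos by (simp add: Suc_diff_le)
      then show ?thesis using s large by (intro expansions_large) auto
    qed
    then show ?thesis using expansions_mono[OF s] by blast
  qed
  show ?thesis
  proof (cases "2 * k \<le> p ^ Suc M")
    case True
    then show ?thesis using half k by blast
  next
    case False
    have "p ^ Suc M > 0" using p_pos by simp
    then have "(p ^ Suc M choose (p ^ Suc M - k)) div p \<in> expansions M"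
      using False k by (intro half) linarith+
    moreover have "p ^ Suc M choose k = p ^ Suc M choose (p ^ Suc M - k)"
      using k by (intro binomial_symmetric) linarith
    ultimately show ?thesis by simp
  qed
qed

lemma binomial_semigroup_eq_expansions:
  fixes p M :: nat
  assumes p: "prime p"
  defines "b \<equiv> \<lambda>i. (p ^ Suc M choose p ^ i) div p"
  shows "binomial_semigroup p (p ^ Suc M) = prime_power_radix.expansions p M b M"
proof
  interpret prime_power_radix p M b
    unfolding b_def using p by (rule prime_power_radix_choose)
  show "binomial_semigroup p (p ^ Suc M) \<subseteq> expansions M"
    unfolding binomial_semigroup_def generated_submonoid_def
    using choose_div_in_expansions[OF p] is_submonoid_expansions
    by (intro hull_minimal) (auto simp: b_def)
  have b: "b i \<in> binomial_semigroup p (p ^ Suc M)" if "i \<le> M" for i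
  proof -
    have "p ^ i < p ^ Suc M" "1 \<le> p ^ i"
      using that prime_gt_1_nat[OF p] by (auto intro!: power_strict_increasing simp: Suc_leI simp del: power_Suc)
    then show ?thesis
      unfolding binomial_semigroup_def generated_submonoid_def b_def
      by (intro hull_inc CollectI exI[of _ "p ^ i"]) auto
  qed
  \<comment> \<open>The generator at \<open>k = 1\<close> is the modulus itself.\<close>
  have "b 0 = p ^ M" using p_pos by (simp add: b_def)
  then show "expansions M \<subseteq> binomial_semigroup p (p ^ Suc M)"
    using b b[of 0]
    by (intro expansions_subset_submonoid)
      (auto simp: binomial_semigroup_def is_submonoid_generated)
qed

theorem corollary3p7:
  fixes p m n :: nat
  assumes "prime p" and "m \<ge> 1" and "n = p ^ m"
  shows
    "real ` apery_set (binomial_semigroup p n) (p ^ (m - 1)) =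
       {1 / real p * (\<Sum>i = 1..m - 1. of_int (c i) * real (n choose (p ^ i))) | c :: nat \<Rightarrow> int.
         \<forall>i \<in> {1..m - 1}. 0 \<le> c i \<and> c i \<le> int p - 1}
     \<and> real_of_int (frobenius_number (binomial_semigroup p n)) =
       (real p - 1) / real p * (\<Sum>i = 1..m - 1. real (p ^ m choose (p ^ i))) - real p ^ (m - 1)
     \<and> real (genus (binomial_semigroup p n)) =
       (real p - 1) / (2 * real p) * (\<Sum>i = 1..m - 1. real (p ^ m choose (p ^ i)))
         - (real p ^ (m - 1) - 1) / 2
     \<and> real_of_int ` pseudo_frobenius (binomial_semigroup p n) =
       {(real p - 1) / real p * (\<Sum>i = 1..m - 1. real (p ^ m choose (p ^ i))) - real p ^ (m - 1)}
     \<and> semigroup_type (binomial_semigroup p n) = 1"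
proof -
  define M where "M = m - 1"
  define b where "b = (\<lambda>i. (p ^ Suc M choose p ^ i) div p)"
  have m: "m = Suc M" using assms(2) by (simp add: M_def)
  interpret prime_power_radix p M b
    unfolding b_def using assms(1) by (rule prime_power_radix_choose)
  let ?A = "\<Sum>i = 1..M. b i"
  interpret symmetric_semigroup "expansions M" "int ((p - 1) * ?A) - int (p ^ M)"
    by (rule symmetric_semigroup_expansions)
  have S: "binomial_semigroup p n = expansions M"
    unfolding assms(3) m b_def using assms(1) by (rule binomial_semigroup_eq_expansions)
  have p0: "real p > 0" using p_pos by simp
  have choose: "real (p ^ m choose p ^ i) = real p * real (b i)" if "i \<in> {1..M}" for i
  proof -
    have "p ^ i < p ^ Suc M" "1 \<le> p ^ i"
      using that prime_gt_1_nat[OF assms(1)]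
      by (auto intro!: power_strict_increasing simp: Suc_leI simp del: power_Suc)
    then have "p dvd (p ^ Suc M choose p ^ i)"
      by (intro prime_dvd_choose_prime_power[OF assms(1)]) auto
    then show ?thesis unfolding m b_def by (metis dvd_mult_div_cancel of_nat_mult)
  qed
  have sum: "(\<Sum>i = 1..m - 1. real (p ^ m choose (p ^ i))) = real p * real ?A"
    unfolding M_def[symmetric] using choose by (simp add: sum_distrib_left)
  let ?F = "(real p - 1) * real ?A - real p ^ M"
  have F: "real_of_int (int ((p - 1) * ?A) - int (p ^ M)) = ?F"
    using p_pos by (simp add: of_nat_diff)
  have F': "(real p - 1) / real p * (\<Sum>i = 1..m - 1. real (p ^ m choose (p ^ i)))
      - real p ^ (m - 1) = ?F"
    unfolding sum using p0 by (simp add: M_def)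
  \<comment> \<open>The factor \<open>p\<close> of each binomial cancels \<open>1 / real p\<close>,
    so the real expression is an integer digit sum.\<close>
  have digits: "1 / real p * (\<Sum>i = 1..m - 1. of_int (c i) * real (n choose (p ^ i)))
      = real_of_int (\<Sum>i = 1..M. c i * int (b i))" for c :: "nat \<Rightarrow> int"
    unfolding M_def[symmetric] assms(3) using choose p0
    by (simp add: sum_distrib_left)
  have apery: "real ` digit_sums M =
      {1 / real p * (\<Sum>i = 1..m - 1. of_int (c i) * real (n choose (p ^ i))) | c :: nat \<Rightarrow> int.
         \<forall>i \<in> {1..m - 1}. 0 \<le> c i \<and> c i \<le> int p - 1}" (is "_ = ?R")
  proof
    show "real ` digit_sums M \<subseteq> ?R"
    proof
      fix x assume "x \<in> real ` digit_sums M"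
      then obtain c where "\<forall>i\<in>{1..M}. c i < p" "x = real (\<Sum>i = 1..M. c i * b i)"
        by (auto simp: digit_sums_def)
      then show "x \<in> ?R" unfolding digits unfolding M_def[symmetric]
        by (intro CollectI exI[of _ "\<lambda>i. int (c i)"]) auto
    qed
    show "?R \<subseteq> real ` digit_sums M"
    proof
      fix x assume "x \<in> ?R"
      then obtain c :: "nat \<Rightarrow> int" where c: "\<forall>i\<in>{1..M}. 0 \<le> c i \<and> c i \<le> int p - 1"
        and x: "x = real_of_int (\<Sum>i = 1..M. c i * int (b i))"
        unfolding digits unfolding M_def[symmetric] by blast
      \<comment> \<open>The digits are nonnegative, so \<open>nat\<close> loses nothing, and
        \<open>c i \<le> int p - 1\<close> becomes \<open>nat (c i) < p\<close>.\<close>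
      have "x = real (\<Sum>i = 1..M. nat (c i) * b i)" using c by (simp add: x)
      moreover have "(\<Sum>i = 1..M. nat (c i) * b i) \<in> digit_sums M"
        using c unfolding digit_sums_def by (intro CollectI exI[of _ "\<lambda>i. nat (c i)"]) force
      ultimately show "x \<in> real ` digit_sums M" by blast
    qed
  qed
  have half_eq: "(real p - 1) / (2 * real p) * (real p * real ?A) = (real p - 1) * real ?A / 2"
    using p0 by simp
  have "2 * real (genus (expansions M)) = ?F + 1"
    unfolding F[symmetric] using arg_cong[OF two_genus_eq, of real_of_int] by simp
  then have "real (genus (expansions M)) =
      (real p - 1) / (2 * real p) * (\<Sum>i = 1..m - 1. real (p ^ m choose (p ^ i)))
         - (real p ^ (m - 1) - 1) / 2"
    unfolding sum unfolding M_def[symmetric] half_eq by (simp add: field_simps)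
  then show ?thesis
    unfolding S F' semigroup_type_def pseudo_frobenius_eq frobenius_number_eq F
    using apery apery_set_expansions F by (simp add: M_def)
qed

end
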